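(* Assume (A1), (A2), (A3) of the context. Let $x^*$ be any stationary point, $\epsilon^*=0$, $\mathcal I^*=\mathcal I(x^* )$, $\mathcal J^*=\mathcal J(x^* )$. Then there exists a sufficiently small neighborhood $B$ of $(x^*,\epsilon^* )$ in $\mathbb R^n\times\mathbb R^n_+$ such that the following hold. (i) For every $(x,\epsilon)\in B$: $S^x(x,\epsilon)\in x^*+\mathcal M_{\mathcal I^*}$ and $\mathrm{sign}(S^x(x,\epsilon))=\mathrm{sign}(x)=\mathrm{sign}(x^* )$. (ii) $S$ is $C^1$ smooth in $B$ and $S^x(x,\epsilon)=x-\frac1\beta g(x,\epsilon)$ with $$g_i(x,\epsilon)=\begin{cases}\beta x_i, & i\in\mathcal J^*,\\ \nabla_i f(x)+\lambda\, r'(x_i\,\mathrm{sign}(x_i^* )+\epsilon_i)\,\mathrm{sign}(x_i^* ), & i\in\mathcal I^*.\end{cases}$$ (iii) The map $T$ is $C^1$ smooth in $B$.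
   Context: Let $f:\mathbb R^n\to\mathbb R$ be twice continuously differentiable, $\lambda>0$, $F(x)=f(x)+\lambda\sum_{i=1}^n r(|x_i|)$. (A1) $r:[0,\infty)\to\mathbb R$ is continuous and concave, $r(0)=0$, $C^2$ on $(0,\infty)$, $r'(t)\ge0$ for all $t>0$, and $r'(0^+):=\lim_{t\to0^+}r'(t)\in(0,\infty]$. (A2) Every $x$ with $0\in\partial F(x)$ satisfies $0\in\mathrm{rint}\,\partial F(x)$ ($\partial F$ the regular subdifferential, $\mathrm{rint}$ the relative interior). (A3) With $F(x,\epsilon)=f(x)+\lambda\sum_i r(|x_i|+\epsilon_i)$ and $F^0=F(x^0,\epsilon^0)$ for the given initial point $(x^0,\epsilon^0)$, the level set $\{x:F(x)\le F^0\}$ is bounded. $\mathcal I(x)=\{i:x_i\ne0\}$, $\mathcal J(x)=\{i:x_i=0\}$, $\mathcal M_{\mathcal I}=\{u\in\mathbb R^n:u_j=0\ \forall j\notin\mathcal I\}$; $\mathrm{sign}$ is applied componentwise with $\mathrm{sign}(0)=0$. A point $x^*$ is stationary if $\nabla_i f(x^* )=-\lambda\,\mathrm{sign}(x_i^* )r'(|x_i^*|)$ for $i\in\mathcal I(x^* )$ and $\nabla_i f(x^* )\in(-\lambda r'(0^+),\lambda r'(0^+))$ for $i\in\mathcal J(x^* )$. Let $\beta>0$, $\alpha,\mu\in(0,1)$. For $x\in\mathbb R^n$, $\epsilon\in\mathbb R^n_+$ let $w_i=r'(|x_i|+\epsilon_i)$ (with $w_i=r'(0^+)$, possibly $+\infty$,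 if $|x_i|+\epsilon_i=0$), and let $S^x(x,\epsilon)\in\mathbb R^n$ have components $S^x_i(x,\epsilon)=\mathrm{sign}(v_i)\max(|v_i|-\lambda w_i/\beta,0)$ with $v=x-\frac1\beta\nabla f(x)$ (equal to $0$ if $w_i=+\infty$). Put $S(x,\epsilon)=(S^x(x,\epsilon),\mu\epsilon)$ and $T=(1-\alpha)I+\alpha S$, i.e. $T(x,\epsilon)=((1-\alpha)x+\alpha S^x(x,\epsilon),\,(1-\alpha(1-\mu))\epsilon)$. $C^1$ on the relatively open subset $B$ of $\mathbb R^n\times\mathbb R^n_+$ means differentiable within $\mathbb R^n\times\mathbb R^n_+$ with continuous derivative.
   Formalization: In (i), sign(x) = sign(x* ) is asserted only for the components in I*; the equality on all components fails in every neighborhood of (x*, 0) when J* is nonempty (e.g. f = x²/2, r(t) = t, λ = 1, x* = 0). sign(S^x) = sign(x* ) is kept for all components. *)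

theory Defs
  imports "HOL-Analysis.Analysis"
begin

definition grad :: "('a::real_inner \<Rightarrow> real) \<Rightarrow> 'a \<Rightarrow> 'a" where
  "grad f x = (THE D. GDERIV f x :> D)"

text \<open>Continuous differentiability on \<open>B \<subseteq> D\<close>, the derivative being taken within \<open>D\<close> and
  depending continuously, in operator norm, on the point of \<open>B\<close>.\<close>

definition C1_within ::
    "'a::real_normed_vector set \<Rightarrow> 'a set \<Rightarrow> ('a \<Rightarrow> 'b::real_normed_vector) \<Rightarrow> bool" where
  "C1_within D B h \<longleftrightarrow>
     (\<exists>h'. (\<forall>z\<in>B. (h has_derivative blinfun_apply (h' z)) (at z within D)) \<and> continuous_on B h')"

definition C2_function :: "('a::real_inner \<Rightarrow> real) \<Rightarrow> bool" where
  "C2_function f \<longleftrightarrow> (\<forall>x. f differentiable at x) \<and> C1_within UNIV UNIV (grad f)"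

text \<open>The limit \<open>r'(0\<^sup>+)\<close>, possibly \<open>\<infinity>\<close>; its existence is part of \<open>assm_A1\<close>.\<close>

definition deriv_at_0plus :: "(real \<Rightarrow> real) \<Rightarrow> ereal" where
  "deriv_at_0plus r = Lim (at_right 0) (\<lambda>t. ereal (deriv r t))"

text \<open>The regularizer \<open>r\<close> lives on \<open>[0,\<infinity>)\<close>; its values at negative arguments are arbitrary and
  never used.\<close>

definition assm_A1 :: "(real \<Rightarrow> real) \<Rightarrow> bool" where
  "assm_A1 r \<longleftrightarrow>
     continuous_on {0..} r \<and> concave_on {0..} r \<and> r 0 = 0 \<and>
     (\<forall>t>0. r differentiable at t) \<and> C1_within {0<..} {0<..} (deriv r) \<and>
     (\<forall>t>0. deriv r t \<ge> 0) \<and>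
     ((\<lambda>t. ereal (deriv r t)) \<longlongrightarrow> deriv_at_0plus r) (at_right 0) \<and>
     deriv_at_0plus r > 0"

definition F_eps ::
    "(real ^ 'n \<Rightarrow> real) \<Rightarrow> (real \<Rightarrow> real) \<Rightarrow> real \<Rightarrow> real ^ 'n \<Rightarrow> real ^ 'n \<Rightarrow> real" where
  "F_eps f r lam x e = f x + lam * (\<Sum>i\<in>UNIV. r (\<bar>x $ i\<bar> + e $ i))"

definition F_obj :: "(real ^ 'n \<Rightarrow> real) \<Rightarrow> (real \<Rightarrow> real) \<Rightarrow> real \<Rightarrow> real ^ 'n \<Rightarrow> real" where
  "F_obj f r lam x = f x + lam * (\<Sum>i\<in>UNIV. r \<bar>x $ i\<bar>)"

text \<open>Regular (Frechet) subdifferential.\<close>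

definition reg_subdiff :: "('a::real_inner \<Rightarrow> real) \<Rightarrow> 'a \<Rightarrow> 'a set" where
  "reg_subdiff F x =
     {v. 0 \<le> Liminf (at x) (\<lambda>y. ereal ((F y - F x - v \<bullet> (y - x)) / norm (y - x)))}"

definition assm_A2 :: "(real ^ 'n \<Rightarrow> real) \<Rightarrow> (real \<Rightarrow> real) \<Rightarrow> real \<Rightarrow> bool" where
  "assm_A2 f r lam \<longleftrightarrow>
     (\<forall>x. 0 \<in> reg_subdiff (F_obj f r lam) x \<longrightarrow>
          0 \<in> rel_interior (reg_subdiff (F_obj f r lam) x))"

definition assm_A3 ::
    "(real ^ 'n \<Rightarrow> real) \<Rightarrow> (real \<Rightarrow> real) \<Rightarrow> real \<Rightarrow> real ^ 'n \<Rightarrow> real ^ 'n \<Rightarrow> bool" where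
  "assm_A3 f r lam x0 e0 \<longleftrightarrow> bounded {x. F_obj f r lam x \<le> F_eps f r lam x0 e0}"

definition supp_I :: "real ^ 'n \<Rightarrow> 'n set" where
  "supp_I x = {i. x $ i \<noteq> 0}"

definition zero_J :: "real ^ 'n \<Rightarrow> 'n set" where
  "zero_J x = {i. x $ i = 0}"

definition subspace_M :: "'n set \<Rightarrow> (real ^ 'n) set" where
  "subspace_M I = {u. \<forall>j. j \<notin> I \<longrightarrow> u $ j = 0}"

text \<open>Componentwise sign; the overloaded \<open>sgn\<close> on vectors is instead normalization.\<close>

definition sign_vec :: "real ^ 'n \<Rightarrow> real ^ 'n" where
  "sign_vec x = (\<chi> i. sgn (x $ i))"

definition stationary :: "(real ^ 'n \<Rightarrow> real) \<Rightarrow> (real \<Rightarrow> real) \<Rightarrow> real \<Rightarrow> real ^ 'n \<Rightarrow> bool" where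
  "stationary f r lam x \<longleftrightarrow>
     (\<forall>i\<in>supp_I x. grad f x $ i = - lam * sgn (x $ i) * deriv r \<bar>x $ i\<bar>) \<and>
     (\<forall>i\<in>zero_J x. - (ereal lam * deriv_at_0plus r) < ereal (grad f x $ i) \<and>
                   ereal (grad f x $ i) < ereal lam * deriv_at_0plus r)"

definition nonneg_orthant :: "(real ^ 'n) set" where
  "nonneg_orthant = {e. \<forall>i. 0 \<le> e $ i}"

definition weight :: "(real \<Rightarrow> real) \<Rightarrow> real ^ 'n \<Rightarrow> real ^ 'n \<Rightarrow> 'n \<Rightarrow> ereal" where
  "weight r x e i =
     (if \<bar>x $ i\<bar> + e $ i = 0 then deriv_at_0plus r else ereal (deriv r (\<bar>x $ i\<bar> + e $ i)))"

definition S_x ::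
    "(real ^ 'n \<Rightarrow> real) \<Rightarrow> (real \<Rightarrow> real) \<Rightarrow> real \<Rightarrow> real \<Rightarrow> real ^ 'n \<Rightarrow> real ^ 'n \<Rightarrow> real ^ 'n" where
  "S_x f r lam beta x e =
     (let v = x - (1 / beta) *\<^sub>R grad f x in
      \<chi> i. if weight r x e i = \<infinity> then 0
           else sgn (v $ i) * max (\<bar>v $ i\<bar> - lam * real_of_ereal (weight r x e i) / beta) 0)"

definition S_map ::
    "(real ^ 'n \<Rightarrow> real) \<Rightarrow> (real \<Rightarrow> real) \<Rightarrow> real \<Rightarrow> real \<Rightarrow> real \<Rightarrow>
     (real ^ 'n) \<times> (real ^ 'n) \<Rightarrow> (real ^ 'n) \<times> (real ^ 'n)" where
  "S_map f r lam beta mu z = (S_x f r lam beta (fst z) (snd z), mu *\<^sub>R snd z)"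

definition T_map ::
    "(real ^ 'n \<Rightarrow> real) \<Rightarrow> (real \<Rightarrow> real) \<Rightarrow> real \<Rightarrow> real \<Rightarrow> real \<Rightarrow> real \<Rightarrow>
     (real ^ 'n) \<times> (real ^ 'n) \<Rightarrow> (real ^ 'n) \<times> (real ^ 'n)" where
  "T_map f r lam beta mu alpha z = (1 - alpha) *\<^sub>R z + alpha *\<^sub>R S_map f r lam beta mu z"

definition g_map ::
    "(real ^ 'n \<Rightarrow> real) \<Rightarrow> (real \<Rightarrow> real) \<Rightarrow> real \<Rightarrow> real \<Rightarrow> real ^ 'n \<Rightarrow>
     real ^ 'n \<Rightarrow> real ^ 'n \<Rightarrow> real ^ 'n" where
  "g_map f r lam beta xs x e =
     (\<chi> i. if i \<in> zero_J xs then beta * x $ i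
           else grad f x $ i + lam * deriv r (x $ i * sgn (xs $ i) + e $ i) * sgn (xs $ i))"

end

theory Submission imports Defs begin

text \<open>Put \<open>G(x, \<epsilon>) = x - g(x, \<epsilon>) / \<beta>\<close>. On the active coordinates \<open>i \<in> \<I>\<^sup>*\<close> the argument
  \<open>x\<^sub>i sign(x\<^sub>i\<^sup>*) + \<epsilon>\<^sub>i\<close> of \<open>r'\<close> stays positive near \<open>(x\<^sup>*, 0)\<close>, even for slightly negative
  \<open>\<epsilon>\<^sub>i\<close>, so \<open>G\<close> is \<open>C\<^sup>1\<close> on a full neighborhood of \<open>(x\<^sup>*, 0)\<close>, and stationarity says that
  \<open>G(x\<^sup>*, 0) = x\<^sup>*\<close>. Hence \<open>G\<^sub>i\<close> keeps the sign of \<open>x\<^sub>i\<^sup>*\<close>, which means precisely that the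
  soft-thresholding is in its shifting branch and \<open>S\<^sup>x\<^sub>i = G\<^sub>i\<close>. On the inactive coordinates the strict
  inequality \<open>\<bar>\<nabla>\<^sub>i f(x\<^sup>*)\<bar> < \<lambda> r'(0\<^sup>+)\<close> persists nearby, so the thresholding returns
  \<open>0 = G\<^sub>i\<close>.\<close>

section \<open>Calculus of continuously differentiable maps relative to an ambient set\<close>

lemma C1_withinI:
  assumes "\<And>z. z \<in> B \<Longrightarrow> (h has_derivative blinfun_apply (h' z)) (at z within D)"
    and "continuous_on B h'"
  shows "C1_within D B h"
  unfolding C1_within_def using assms by (intro exI[of _ h']) simp

text \<open>Fewer comparison points only weaken differentiability within a set. This carries
  smoothness on a full neighborhood over to the orthant.\<close>

lemma C1_within_subset:
  assumes "C1_within D B h" "D' \<subseteq> D" "B' \<subseteq> B"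
  shows "C1_within D' B' h"
proof -
  obtain h' where h': "\<forall>z\<in>B. (h has_derivative blinfun_apply (h' z)) (at z within D)"
    and ch: "continuous_on B h'"
    using assms(1) unfolding C1_within_def by (elim exE conjE)
  show ?thesis
  proof (rule C1_withinI)
    show "(h has_derivative blinfun_apply (h' z)) (at z within D')" if "z \<in> B'" for z
      using that assms(3) by (intro has_derivative_subset[OF bspec[OF h'] assms(2)]) (rule subsetD)
    show "continuous_on B' h'"
      by (rule continuous_on_subset[OF ch assms(3)])
  qed
qed

text \<open>Turns the smoothness of \<open>deriv r\<close> within the open half-line into
  unrestricted differentiability there: the chain rule below wants the ambient set of the outer map
  to contain the image of the whole inner ambient set.\<close>

lemma C1_within_open:
  assumes "C1_within B B h" "open B"
  shows "C1_within UNIV B h"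
proof -
  obtain h' where h': "\<forall>z\<in>B. (h has_derivative blinfun_apply (h' z)) (at z within B)"
    and ch': "continuous_on B h'"
    using assms(1) unfolding C1_within_def by (elim exE conjE)
  show ?thesis
  proof (rule C1_withinI[OF _ ch'])
    show "(h has_derivative blinfun_apply (h' z)) (at z)" if "z \<in> B" for z
      using bspec[OF h' that] unfolding at_within_open[OF that assms(2)] .
  qed
qed

text \<open>The derivative at \<open>z\<close> compares with all nearby points of \<open>D\<close>;
  relative openness places these in \<open>B\<close>, where the two maps agree.\<close>

lemma C1_within_cong:
  assumes "C1_within D B h" "openin (top_of_set D) B" "\<And>z. z \<in> B \<Longrightarrow> h z = k z"
  shows "C1_within D B k"
proof -
  obtain h' where h': "\<forall>z\<in>B. (h has_derivative blinfun_apply (h' z)) (at z within D)"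
    and ch: "continuous_on B h'"
    using assms(1) unfolding C1_within_def by (elim exE conjE)
  show ?thesis
  proof (rule C1_withinI[OF _ ch])
    fix z assume z: "z \<in> B"
    obtain d where d: "d > 0" "ball z d \<inter> D \<subseteq> B" "z \<in> D"
      using assms(2) z unfolding openin_contains_ball by blast
    have "h y = k y" if "y \<in> D" "dist y z < d" for y
    proof (rule assms(3))
      show "y \<in> B" using that d(2) by (auto simp: dist_commute)
    qed
    then show "(k has_derivative blinfun_apply (h' z)) (at z within D)"
      by (rule has_derivative_transform_within[OF bspec[OF h' z] d(1,3)])
  qed
qed

lemma C1_within_imp_isCont:
  assumes "C1_within UNIV B h" "z \<in> B"
  shows "isCont h z"
proof -
  obtain h' where "\<forall>z\<in>B. (h has_derivative blinfun_apply (h' z)) (at z)" "continuous_on B h'"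
    using assms(1) unfolding C1_within_def by (elim exE conjE)
  from has_derivative_continuous[OF bspec[OF this(1) assms(2)]] show ?thesis .
qed

lemma isCont_imp_tendsto_nhds:
  assumes "isCont h a" "h a = l"
  shows "(h \<longlongrightarrow> l) (nhds a)"
  using assms unfolding continuous_at tendsto_at_iff_tendsto_nhds by simp

lemma C1_within_const: "C1_within D B (\<lambda>z. c)"
  by (rule C1_withinI[where h' = "\<lambda>z. 0"]) (simp_all add: zero_blinfun.rep_eq)

lemma C1_within_bounded_linear:
  assumes "bounded_linear L"
  shows "C1_within D B L"
  by (rule C1_withinI[where h' = "\<lambda>z. Blinfun L"])
     (simp_all add: bounded_linear_Blinfun_apply assms bounded_linear_imp_has_derivative)

lemma C1_within_compose:
  assumes "C1_within D B h" "C1_within E C k" "h ` D \<subseteq> E" "h ` B \<subseteq> C" "B \<subseteq> D"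
  shows "C1_within D B (\<lambda>z. k (h z))"
proof -
  obtain h' where h': "\<forall>z\<in>B. (h has_derivative blinfun_apply (h' z)) (at z within D)"
    and ch': "continuous_on B h'"
    using assms(1) unfolding C1_within_def by (elim exE conjE)
  obtain k' where k': "\<forall>z\<in>C. (k has_derivative blinfun_apply (k' z)) (at z within E)"
    and ck': "continuous_on C k'"
    using assms(2) unfolding C1_within_def by (elim exE conjE)
  show ?thesis
  proof (rule C1_withinI)
    fix z assume z: "z \<in> B"
    then have "h z \<in> C"
      using assms(4) by blast
    from has_derivative_in_compose[OF bspec[OF h' z] has_derivative_subset[OF bspec[OF k' this] assms(3)]]
    show "((\<lambda>z. k (h z)) has_derivative blinfun_apply (k' (h z) o\<^sub>L h' z)) (at z within D)"
      by (simp add: o_def blinfun_compose.rep_eq)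
  next
    have "continuous_on B h"
      unfolding continuous_on_eq_continuous_within
      using continuous_within_subset[OF has_derivative_continuous[OF bspec[OF h']] assms(5)] by simp
    then have "continuous_on B (\<lambda>z. k' (h z))"
      by (rule continuous_on_compose2[OF ck' _ assms(4)])
    then show "continuous_on B (\<lambda>z. k' (h z) o\<^sub>L h' z)"
      using ch' by (intro continuous_intros)
  qed
qed

text \<open>The derivative of \<open>L\<close> is constant. Applied to scalings, coordinates and
  injections into a product or along a basis vector, this rule and the one for sums yield the
  remaining algebraic rules.\<close>

lemma C1_within_compose_bounded_linear:
  assumes "bounded_linear L" "C1_within D B h"
  shows "C1_within D B (\<lambda>z. L (h z))"
proof -
  obtain h' where h': "\<forall>z\<in>B. (h has_derivative blinfun_apply (h' z)) (at z within D)"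
    and ch': "continuous_on B h'"
    using assms(2) unfolding C1_within_def by (elim exE conjE)
  show ?thesis
  proof (rule C1_withinI)
    show "((\<lambda>z. L (h z)) has_derivative blinfun_apply (Blinfun L o\<^sub>L h' z)) (at z within D)"
      if "z \<in> B" for z
      using bounded_linear.has_derivative[OF assms(1) bspec[OF h' that]]
      by (simp add: o_def blinfun_compose.rep_eq bounded_linear_Blinfun_apply[OF assms(1)])
    show "continuous_on B (\<lambda>z. Blinfun L o\<^sub>L h' z)"
      using ch' by (intro continuous_intros)
  qed
qed

lemma C1_within_add:
  assumes "C1_within D B h" "C1_within D B k"
  shows "C1_within D B (\<lambda>z. h z + k z)"
proof -
  obtain h' where h': "\<forall>z\<in>B. (h has_derivative blinfun_apply (h' z)) (at z within D)"
    and ch': "continuous_on B h'"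
    using assms(1) unfolding C1_within_def by (elim exE conjE)
  obtain k' where k': "\<forall>z\<in>B. (k has_derivative blinfun_apply (k' z)) (at z within D)"
    and ck': "continuous_on B k'"
    using assms(2) unfolding C1_within_def by (elim exE conjE)
  show ?thesis
  proof (rule C1_withinI[OF _ continuous_on_add[OF ch' ck']])
    show "((\<lambda>z. h z + k z) has_derivative blinfun_apply (h' z + k' z)) (at z within D)"
      if "z \<in> B" for z
      using has_derivative_add[OF bspec[OF h' that] bspec[OF k' that]] by (simp add: plus_blinfun.rep_eq)
  qed
qed

lemma C1_within_diff:
  assumes "C1_within D B h" "C1_within D B k"
  shows "C1_within D B (\<lambda>z. h z - k z)"
  using C1_within_add[OF assms(1) C1_within_compose_bounded_linear[OF
      bounded_linear_minus[OF bounded_linear_ident] assms(2)]] by simp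

lemma C1_within_sum:
  assumes "\<And>i. i \<in> A \<Longrightarrow> C1_within D B (h i)"
  shows "C1_within D B (\<lambda>z. \<Sum>i\<in>A. h i z)"
  using assms by (induction A rule: infinite_finite_induct) (auto intro: C1_within_const C1_within_add)

lemma C1_within_vec:
  fixes h :: "'a::real_normed_vector \<Rightarrow> real ^ 'n"
  assumes "\<And>i. C1_within D B (\<lambda>z. h z $ i)"
  shows "C1_within D B h"
proof -
  have "C1_within D B (\<lambda>z. \<Sum>i\<in>UNIV. (h z $ i) *\<^sub>R axis i (1::real))"
    by (intro C1_within_sum C1_within_compose_bounded_linear[OF bounded_linear_scaleR_left] assms)
  moreover have "(\<Sum>i\<in>UNIV. (h z $ i) *\<^sub>R axis i (1::real)) = h z" for z
    using basis_expansion[of "h z"] by (simp add: scalar_mult_eq_scaleR)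
  ultimately show ?thesis by simp
qed

lemma C1_within_Pair:
  assumes "C1_within D B h" "C1_within D B k"
  shows "C1_within D B (\<lambda>z. (h z, k z))"
  using C1_within_add[OF
      C1_within_compose_bounded_linear[OF bounded_linear_Pair[OF bounded_linear_ident bounded_linear_zero] assms(1)]
      C1_within_compose_bounded_linear[OF bounded_linear_Pair[OF bounded_linear_zero bounded_linear_ident] assms(2)]]
  by simp

section \<open>The smooth candidate \<open>G\<close> and its open domain\<close>

definition active_region :: "real ^ 'n \<Rightarrow> ((real ^ 'n) \<times> (real ^ 'n)) set" where
  "active_region xs =
     {z. \<forall>i\<in>supp_I xs. 0 < fst z $ i * sgn (xs $ i) \<and> 0 < fst z $ i * sgn (xs $ i) + snd z $ i}"

text \<open>The second inequality in \<open>active_region\<close> is a condition of its own because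
  \<open>snd z\<close> may be negative; allowing that makes the region open around a boundary point
  of the orthant.\<close>

lemma open_active_region: "open (active_region xs)"
proof -
  have eq: "active_region xs = (\<Inter>i\<in>supp_I xs. {z. 0 < fst z $ i * sgn (xs $ i)} \<inter>
    {z. 0 < fst z $ i * sgn (xs $ i) + snd z $ i})"
    unfolding active_region_def by auto
  show ?thesis
    unfolding eq by (intro open_INT ballI open_Int open_Collect_less continuous_intros) auto
qed

lemma center_in_active_region: "(xs, 0) \<in> active_region xs"
  by (auto simp: active_region_def supp_I_def simp flip: abs_sgn)

definition smooth_S_x ::
    "(real ^ 'n \<Rightarrow> real) \<Rightarrow> (real \<Rightarrow> real) \<Rightarrow> real \<Rightarrow> real \<Rightarrow> real ^ 'n \<Rightarrow>
     (real ^ 'n) \<times> (real ^ 'n) \<Rightarrow> real ^ 'n" where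
  "smooth_S_x f r lam beta xs z = fst z - (1 / beta) *\<^sub>R g_map f r lam beta xs (fst z) (snd z)"

lemma smooth_S_x_zero:
  assumes "beta \<noteq> 0" "i \<notin> supp_I xs"
  shows "smooth_S_x f r lam beta xs z $ i = 0"
  using assms by (simp add: smooth_S_x_def g_map_def zero_J_def supp_I_def)

lemma smooth_S_x_supp:
  assumes "i \<in> supp_I xs"
  shows "smooth_S_x f r lam beta xs z $ i = fst z $ i - (1 / beta) * (grad f (fst z) $ i +
    lam * deriv r (fst z $ i * sgn (xs $ i) + snd z $ i) * sgn (xs $ i))"
  using assms by (simp add: smooth_S_x_def g_map_def zero_J_def supp_I_def)

text \<open>On the support the gradient equation cancels the two terms of \<open>g_map\<close>, as
  \<open>xs $ i * sgn (xs $ i)\<close> is \<open>\<bar>xs $ i\<bar>\<close>; elsewhere both sides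
  vanish.\<close>

lemma smooth_S_x_stationary:
  assumes "beta \<noteq> 0" "stationary f r lam xs"
  shows "smooth_S_x f r lam beta xs (xs, 0) = xs"
proof (rule vec_eq_iff[THEN iffD2, rule_format])
  fix i
  show "smooth_S_x f r lam beta xs (xs, 0) $ i = xs $ i"
  proof (cases "i \<in> supp_I xs")
    case True
    then have "grad f xs $ i = - lam * sgn (xs $ i) * deriv r \<bar>xs $ i\<bar>"
      using assms(2) unfolding stationary_def by blast
    then show ?thesis
      using True by (simp add: smooth_S_x_supp flip: abs_sgn)
  next
    case False
    then show ?thesis
      using smooth_S_x_zero[OF assms(1) False] by (simp add: supp_I_def)
  qed
qed

lemma C1_smooth_S_x:
  assumes "C2_function f" "assm_A1 r" "beta \<noteq> 0"
  shows "C1_within UNIV (active_region xs) (smooth_S_x f r lam beta xs)"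
proof (rule C1_within_vec)
  fix i
  let ?U = "active_region xs" and ?s = "sgn (xs $ i)"
  have nth: "bounded_linear (\<lambda>z. z $ i)" by (rule bounded_linear_vec_nth)
  have x: "C1_within UNIV ?U (\<lambda>z. fst z $ i)"
    by (rule C1_within_compose_bounded_linear[OF nth C1_within_bounded_linear[OF bounded_linear_fst]])
  have e: "C1_within UNIV ?U (\<lambda>z. snd z $ i)"
    by (rule C1_within_compose_bounded_linear[OF nth C1_within_bounded_linear[OF bounded_linear_snd]])
  have "C1_within UNIV UNIV (grad f)"
    using assms(1) unfolding C2_function_def by blast
  then have g: "C1_within UNIV ?U (\<lambda>z. grad f (fst z) $ i)"
    by (intro C1_within_compose_bounded_linear[OF nth]
        C1_within_compose[OF C1_within_bounded_linear[OF bounded_linear_fst]]) auto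
  show "C1_within UNIV ?U (\<lambda>z. smooth_S_x f r lam beta xs z $ i)"
  proof (cases "i \<in> supp_I xs")
    case True
    have "C1_within {0<..} {0<..} (deriv r)"
      using assms(2) unfolding assm_A1_def by blast
    then have "C1_within UNIV {0<..} (deriv r)"
      by (rule C1_within_open) simp
    \<comment> \<open>The inequalities of the region keep the argument of \<open>deriv r\<close>
      positive, where it is smooth.\<close>
    then have "C1_within UNIV ?U (\<lambda>z. deriv r (fst z $ i * ?s + snd z $ i))"
      by (rule C1_within_compose[OF C1_within_add[OF
          C1_within_compose_bounded_linear[OF bounded_linear_mult_left x] e]])
         (use True in \<open>auto simp: active_region_def\<close>)
    from C1_within_compose_bounded_linear[OF bounded_linear_mult_left, OF
        C1_within_compose_bounded_linear[OF bounded_linear_mult_right, OF this]]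
    have "C1_within UNIV ?U (\<lambda>z. lam * deriv r (fst z $ i * ?s + snd z $ i) * ?s)" .
    from C1_within_diff[OF x
        C1_within_compose_bounded_linear[OF bounded_linear_mult_right, OF C1_within_add[OF g this]]]
    have "C1_within UNIV ?U (\<lambda>z. fst z $ i - (1 / beta) * (grad f (fst z) $ i +
        lam * deriv r (fst z $ i * ?s + snd z $ i) * ?s))" .
    then show ?thesis
      by (simp add: smooth_S_x_supp[OF True])
  next
    case False
    then show ?thesis
      using assms(3) by (simp add: smooth_S_x_zero C1_within_const)
  qed
qed

section \<open>Soft-thresholding near the stationary point\<close>

lemma S_x_eq_smooth_supp:
  assumes "assm_A1 r" "lam > 0" "beta > 0" "i \<in> supp_I xs"
    and U: "(x, e) \<in> active_region xs"
    and pos: "0 < smooth_S_x f r lam beta xs (x, e) $ i * sgn (xs $ i)"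
  shows "S_x f r lam beta x e $ i = smooth_S_x f r lam beta xs (x, e) $ i"
proof -
  define s where "s = sgn (xs $ i)"
  have s: "s = 1 \<or> s = - 1"
    using assms(4) by (auto simp: s_def supp_I_def sgn_if)
  define t where "t = x $ i * s + e $ i"
  have xt: "0 < x $ i * s" "0 < t"
    using U assms(4) by (auto simp: active_region_def s_def t_def)
  then have abs: "\<bar>x $ i\<bar> + e $ i = t"
    using s by (auto simp: t_def)
  \<comment> \<open>The threshold is nonnegative because \<open>r\<close> has nonnegative
    derivative.\<close>
  have w: "0 \<le> lam * deriv r t / beta"
    using assms(1-3) xt unfolding assm_A1_def by simp
  define v where "v = x $ i - (1 / beta) * grad f x $ i"
  have G: "smooth_S_x f r lam beta xs (x, e) $ i = v - lam * deriv r t / beta * s"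
    using assms(4) by (simp add: smooth_S_x_supp v_def t_def s_def ring_distribs)
  have "S_x f r lam beta x e $ i = sgn v * max (\<bar>v\<bar> - lam * deriv r t / beta) 0"
    using xt by (simp add: S_x_def Let_def weight_def abs v_def)
  \<comment> \<open>Hence \<open>v * s\<close> exceeds the threshold: \<open>v\<close> has sign
    \<open>s\<close>, the maximum is its first entry, and \<open>s * \<bar>v\<bar>\<close> is
    \<open>v\<close>.\<close>
  moreover have "0 < (v - lam * deriv r t / beta * s) * s"
    using pos unfolding G s_def .
  ultimately show ?thesis
    using s w unfolding G by (auto simp: sgn_if)
qed

text \<open>The number \<open>c\<close> separates the gradient step from the threshold: after
  division by \<open>beta\<close> the former is below \<open>c / beta\<close> in modulus and the
  latter above it.\<close>

lemma S_x_eq_0: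
  assumes "beta > 0" "lam > 0" "\<bar>beta * x $ i - grad f x $ i\<bar> < c" "ereal (c / lam) < weight r x e i"
  shows "S_x f r lam beta x e $ i = 0"
proof (cases "weight r x e i")
  case (real w)
  have "x $ i - grad f x $ i / beta = (beta * x $ i - grad f x $ i) / beta"
    using assms(1) by (simp add: field_simps)
  then have "\<bar>x $ i - grad f x $ i / beta\<bar> = \<bar>beta * x $ i - grad f x $ i\<bar> / beta"
    using assms(1) by simp
  also have "\<dots> \<le> lam * w / beta"
    using assms real by (intro divide_right_mono) (auto simp: field_simps)
  finally show ?thesis
    using real by (simp add: S_x_def Let_def)
\<comment> \<open>An infinite weight gives zero by the convention in \<open>S_x\<close>; the lower
  bound excludes \<open>-\<infinity>\<close>.\<close>
qed (use assms(4) in \<open>auto simp: S_x_def Let_def\<close>)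

text \<open>The neighborhood is taken in the full space, with the orthant as a premise, so that it
  can be intersected with the open sets on which \<open>G\<close> is controlled.\<close>

lemma eventually_S_x_eq_0:
  fixes xs :: "real ^ 'n"
  assumes "C2_function f" "assm_A1 r" "lam > 0" "beta > 0" "stationary f r lam xs" "i \<notin> supp_I xs"
  shows "\<forall>\<^sub>F z in nhds (xs, 0). snd z \<in> nonneg_orthant \<longrightarrow> S_x f r lam beta (fst z) (snd z) $ i = 0"
proof -
  let ?z0 = "(xs, 0) :: (real ^ 'n) \<times> (real ^ 'n)"
  have i: "xs $ i = 0" "i \<in> zero_J xs"
    using assms(6) by (auto simp: supp_I_def zero_J_def)
  define R where "R = deriv_at_0plus r"
  have R: "0 < R" "- (ereal lam * R) < ereal (grad f xs $ i)" "ereal (grad f xs $ i) < ereal lam * R"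
    using assms(2,5) i(2) unfolding assm_A1_def stationary_def R_def by auto
  \<comment> \<open>Strict stationarity leaves room for \<open>c\<close> between the gradient
    component and \<open>lam * R\<close>: by density if \<open>R\<close> is finite, and with any
    larger number if it is infinite.\<close>
  obtain c where c: "\<bar>grad f xs $ i\<bar> < c" "ereal (c / lam) < R"
  proof (cases R)
    case (real q)
    then have "\<bar>grad f xs $ i\<bar> < lam * q"
      using R by auto
    then obtain c where "\<bar>grad f xs $ i\<bar> < c" "c < lam * q"
      using dense by blast
    then show ?thesis
      using that real assms(3) by (simp add: field_simps)
  next
    case PInf
    then show ?thesis
      using that[of "\<bar>grad f xs $ i\<bar> + 1"] by simp
  qed (use R(1) in auto)
  have "((\<lambda>t. ereal (deriv r t)) \<longlongrightarrow> R) (at_right 0)"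
    using assms(2) unfolding assm_A1_def R_def by blast
  then have "\<forall>\<^sub>F t in at_right 0. ereal (c / lam) < ereal (deriv r t)"
    using c(2) by (rule order_tendstoD)
  then obtain d where d: "0 < d" "\<And>t. 0 < t \<Longrightarrow> t < d \<Longrightarrow> ereal (c / lam) < ereal (deriv r t)"
    unfolding eventually_at_right_field by blast
  have "C1_within UNIV UNIV (grad f)"
    using assms(1) unfolding C2_function_def by blast
  then have "isCont (grad f) xs"
    by (rule C1_within_imp_isCont) simp
  then have "isCont (\<lambda>z. grad f (fst z)) ?z0"
    using isCont_o2[where f = fst and g = "grad f" and a = "?z0"] by simp
  then have "isCont (\<lambda>z. \<bar>beta * fst z $ i - grad f (fst z) $ i\<bar>) ?z0"
    by (intro continuous_intros)
  then have "((\<lambda>z. \<bar>beta * fst z $ i - grad f (fst z) $ i\<bar>) \<longlongrightarrow> \<bar>grad f xs $ i\<bar>) (nhds ?z0)"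
    by (rule isCont_imp_tendsto_nhds) (simp add: i(1))
  then have near: "\<forall>\<^sub>F z in nhds ?z0. \<bar>beta * fst z $ i - grad f (fst z) $ i\<bar> < c"
    using c(1) by (rule order_tendstoD)
  have "isCont (\<lambda>z. \<bar>fst z $ i\<bar> + snd z $ i) ?z0"
    by (intro continuous_intros)
  then have "((\<lambda>z. \<bar>fst z $ i\<bar> + snd z $ i) \<longlongrightarrow> 0) (nhds ?z0)"
    by (rule isCont_imp_tendsto_nhds) (simp add: i(1))
  then have "\<forall>\<^sub>F z in nhds ?z0. \<bar>fst z $ i\<bar> + snd z $ i < d"
    using d(1) by (rule order_tendstoD)
  with near show ?thesis
  proof eventually_elim
    case (elim z)
    show ?case
    proof
      assume "snd z \<in> nonneg_orthant"
      \<comment> \<open>Two cases remain: at zero the weight is \<open>R\<close> itself, and between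
        \<open>0\<close> and \<open>d\<close> the one-sided limit bounds \<open>deriv r\<close>.
        Negative arguments would be uncontrolled.\<close>
      then have "0 \<le> \<bar>fst z $ i\<bar> + snd z $ i"
        by (simp add: nonneg_orthant_def)
      then have "ereal (c / lam) < weight r (fst z) (snd z) i"
        using c(2) d(2)[of "\<bar>fst z $ i\<bar> + snd z $ i"] elim(2) unfolding weight_def R_def by auto
      with elim(1) show "S_x f r lam beta (fst z) (snd z) $ i = 0"
        by (rule S_x_eq_0[OF assms(4,3)])
    qed
  qed
qed

text \<open>At \<open>(xs, 0)\<close> the product equals \<open>\<bar>xs $ i\<bar>\<close>, which is
  positive on the support; continuity does the rest.\<close>

lemma eventually_smooth_S_x_sign:
  assumes "C2_function f" "assm_A1 r" "beta \<noteq> 0" "stationary f r lam xs" "i \<in> supp_I xs"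
  shows "\<forall>\<^sub>F z in nhds (xs, 0). 0 < smooth_S_x f r lam beta xs z $ i * sgn (xs $ i)"
proof -
  have "isCont (smooth_S_x f r lam beta xs) (xs, 0)"
    using C1_within_imp_isCont C1_smooth_S_x[OF assms(1-3)] center_in_active_region by blast
  then have "isCont (\<lambda>z. smooth_S_x f r lam beta xs z $ i * sgn (xs $ i)) (xs, 0)"
    by (intro continuous_intros)
  then have "((\<lambda>z. smooth_S_x f r lam beta xs z $ i * sgn (xs $ i)) \<longlongrightarrow> \<bar>xs $ i\<bar>) (nhds (xs, 0))"
    by (rule isCont_imp_tendsto_nhds) (simp add: smooth_S_x_stationary[OF assms(3,4)] abs_sgn)
  then show ?thesis
    using assms(5) by (intro order_tendstoD(1)) (auto simp: supp_I_def)
qed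

section \<open>One neighborhood for all coordinates, and smoothness of \<open>S\<close> and
  \<open>T\<close> on it\<close>

theorem theorem3p4:
  fixes f :: "real ^ 'n \<Rightarrow> real"
    and r :: "real \<Rightarrow> real"
    and lam alpha beta mu :: real
    and x0 e0 xs :: "real ^ 'n"
  assumes "C2_function f"
    and "lam > 0"
    and "beta > 0"
    and "0 < alpha" and "alpha < 1"
    and "0 < mu" and "mu < 1"
    and "e0 \<in> nonneg_orthant"
    and "assm_A1 r"
    and "assm_A2 f r lam"
    and "assm_A3 f r lam x0 e0"
    and "stationary f r lam xs"
  shows "\<exists>B. openin (top_of_set (UNIV \<times> nonneg_orthant)) B \<and> (xs, 0) \<in> B \<and>
    (\<forall>(x, e)\<in>B.
       S_x f r lam beta x e \<in> (+) xs ` subspace_M (supp_I xs) \<and>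
       sign_vec (S_x f r lam beta x e) = sign_vec xs \<and>
       (\<forall>i\<in>supp_I xs. sgn (x $ i) = sgn (xs $ i))) \<and>
    C1_within (UNIV \<times> nonneg_orthant) B (S_map f r lam beta mu) \<and>
    (\<forall>(x, e)\<in>B. S_x f r lam beta x e = x - (1 / beta) *\<^sub>R g_map f r lam beta xs x e) \<and>
    C1_within (UNIV \<times> nonneg_orthant) B (T_map f r lam beta mu alpha)"
proof -
  let ?D = "UNIV \<times> nonneg_orthant :: ((real ^ 'n) \<times> (real ^ 'n)) set"
  let ?G = "smooth_S_x f r lam beta xs"
  have beta: "beta \<noteq> 0" using assms(3) by simp
  \<comment> \<open>There are finitely many indices, so the coordinatewise conditions hold on a
    common neighborhood.\<close>
  have "\<forall>\<^sub>F z in nhds (xs, 0). z \<in> active_region xs \<and>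
      (\<forall>i\<in>supp_I xs. 0 < ?G z $ i * sgn (xs $ i)) \<and>
      (\<forall>i\<in>- supp_I xs. snd z \<in> nonneg_orthant \<longrightarrow> S_x f r lam beta (fst z) (snd z) $ i = 0)"
    using assms(1,2,3,9,12) beta
    by (intro eventually_conj eventually_ball_finite ballI eventually_S_x_eq_0
        eventually_smooth_S_x_sign eventually_nhds_in_open open_active_region
        center_in_active_region) auto
  then obtain U where U: "open U" "(xs, 0) \<in> U" "U \<subseteq> active_region xs"
    and pos: "\<And>z i. z \<in> U \<Longrightarrow> i \<in> supp_I xs \<Longrightarrow> 0 < ?G z $ i * sgn (xs $ i)"
    and zero: "\<And>z i. z \<in> U \<Longrightarrow> i \<notin> supp_I xs \<Longrightarrow> snd z \<in> nonneg_orthant \<Longrightarrow>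
        S_x f r lam beta (fst z) (snd z) $ i = 0"
    unfolding eventually_nhds by (auto simp: subset_iff)
  define B where "B = ?D \<inter> U"
  have B: "openin (top_of_set ?D) B"
    unfolding B_def using U(1) by (rule openin_open_Int)
  have S_eq: "S_x f r lam beta x e = ?G (x, e)" if "(x, e) \<in> B" for x e
  proof (rule vec_eq_iff[THEN iffD2, rule_format])
    fix i
    show "S_x f r lam beta x e $ i = ?G (x, e) $ i"
    proof (cases "i \<in> supp_I xs")
      case True
      then show ?thesis
        using that U(3) pos by (intro S_x_eq_smooth_supp assms(9,2,3)) (auto simp: B_def)
    next
      case False
      then show ?thesis
        using that zero[of "(x, e)" i] smooth_S_x_zero[OF beta False] by (simp add: B_def)
    qed
  qed
  have sgn_eq: "sgn a = sgn b" if "0 < a * sgn b" for a b :: real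
    using that by (auto simp: sgn_if split: if_splits)
  \<comment> \<open>For \<open>x\<close> itself signs are compared on the support only: off it,
    \<open>x\<close> may have small nonzero coordinates of either sign, while \<open>S_x\<close> is
    zero there.\<close>
  have sign: "S_x f r lam beta x e \<in> (+) xs ` subspace_M (supp_I xs) \<and>
       sign_vec (S_x f r lam beta x e) = sign_vec xs \<and>
       (\<forall>i\<in>supp_I xs. sgn (x $ i) = sgn (xs $ i))" if "(x, e) \<in> B" for x e
  proof (intro conjI ballI)
    have "?G (x, e) - xs \<in> subspace_M (supp_I xs)"
      using smooth_S_x_zero[OF beta] by (auto simp: subspace_M_def supp_I_def)
    then show "S_x f r lam beta x e \<in> (+) xs ` subspace_M (supp_I xs)"
      unfolding S_eq[OF that] by (rule rev_image_eqI) simp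
    have "sgn (?G (x, e) $ i) = sgn (xs $ i)" for i
    proof (cases "i \<in> supp_I xs")
      case True
      then show ?thesis using that by (intro sgn_eq pos) (auto simp: B_def)
    next
      case False
      then show ?thesis using smooth_S_x_zero[OF beta False] by (simp add: supp_I_def)
    qed
    then show "sign_vec (S_x f r lam beta x e) = sign_vec xs"
      unfolding S_eq[OF that] by (simp add: sign_vec_def)
    show "sgn (x $ i) = sgn (xs $ i)" if "i \<in> supp_I xs" for i
      using that \<open>(x, e) \<in> B\<close> U(3) by (intro sgn_eq) (auto simp: B_def active_region_def)
  qed
  \<comment> \<open>Smoothness is first shown for \<open>G\<close> on the open region, then
    restricted to the orthant, and only there passed to \<open>S\<close>, with which
    \<open>G\<close> agrees on \<open>B\<close>.\<close>
  have "C1_within UNIV (active_region xs) (\<lambda>z. (?G z, mu *\<^sub>R snd z))"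
    by (intro C1_within_Pair C1_smooth_S_x assms(1,9) beta
        C1_within_compose_bounded_linear[OF bounded_linear_scaleR_right]
        C1_within_bounded_linear bounded_linear_snd)
  then have "C1_within ?D B (\<lambda>z. (?G z, mu *\<^sub>R snd z))"
    by (rule C1_within_subset) (use U(3) in \<open>auto simp: B_def\<close>)
  then have S: "C1_within ?D B (S_map f r lam beta mu)"
    by (rule C1_within_cong[OF _ B]) (use S_eq in \<open>auto simp: S_map_def\<close>)
  have "C1_within ?D B (\<lambda>z. (1 - alpha) *\<^sub>R z + alpha *\<^sub>R S_map f r lam beta mu z)"
    by (intro C1_within_add S C1_within_compose_bounded_linear[OF bounded_linear_scaleR_right]
        C1_within_bounded_linear bounded_linear_scaleR_right)
  then have T: "C1_within ?D B (T_map f r lam beta mu alpha)"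
    unfolding T_map_def[abs_def] .
  have "(xs, 0) \<in> B"
    using U(2) by (simp add: B_def nonneg_orthant_def)
  moreover have "\<forall>(x, e)\<in>B. S_x f r lam beta x e = x - (1 / beta) *\<^sub>R g_map f r lam beta xs x e"
    using S_eq by (auto simp: smooth_S_x_def)
  ultimately show ?thesis
    using B sign S T by (intro exI[of _ B]) blast
qed

end
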